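(* Let $K$ and $L$ be étale bigraphs. Then $\rho(K\times_{B_2}L)\le\rho(K)\,\rho(L)$.
   Context: A digraph $G=(V_G,E_G,t_G,h_G)$ consists of finite sets $V_G,E_G$ and maps $t_G,h_G\colon E_G\to V_G$ (tail, head); multiple edges and self-loops are allowed. A bigraph is a digraph each of whose edges is coloured $1$ or $2$; it is étale if no vertex is the head of two distinct edges of the same colour and no vertex is the tail of two distinct edges of the same colour. For bigraphs $K,L$, the fibre product $K\times_{B_2}L$ is the digraph with vertex set $V_K\times V_L$, edge set the pairs $(e_1,e_2)\in E_K\times E_L$ with $e_1,e_2$ of the same colour, tail $(t e_1,te_2)$ and head $(he_1,he_2)$. For a digraph $G$ regarded as an undirected graph and a connected component $X$, let $h_1(X)=|E_X|-|V_X|+1$; the reduced cyclicity is $\rho(G)=\sum_{X}\max(0,h_1(X)-1)$, the sum over connected components $X$ of $G$. *)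

theory Defs
  imports Main
begin

text \<open>A digraph: finite vertex and edge sets with tail and head maps.
  Multiple edges and self-loops are allowed.\<close>
record ('v, 'e) digraph =
  dverts :: "'v set"
  dedges :: "'e set"
  dtail  :: "'e \<Rightarrow> 'v"
  dhead  :: "'e \<Rightarrow> 'v"

text \<open>A bigraph: a digraph whose edges are coloured 1 or 2.\<close>
record ('v, 'e) bigraph = "('v, 'e) digraph" +
  dcol :: "'e \<Rightarrow> nat"

definition is_digraph :: "('v, 'e, 'z) digraph_scheme \<Rightarrow> bool" where
  "is_digraph G \<longleftrightarrow> finite (dverts G) \<and> finite (dedges G)
     \<and> (\<forall>e\<in>dedges G. dtail G e \<in> dverts G \<and> dhead G e \<in> dverts G)"

definition is_bigraph :: "('v, 'e, 'z) bigraph_scheme \<Rightarrow> bool" where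
  "is_bigraph K \<longleftrightarrow> is_digraph K \<and> (\<forall>e\<in>dedges K. dcol K e \<in> {1, 2})"

definition etale :: "('v, 'e, 'z) bigraph_scheme \<Rightarrow> bool" where
  "etale K \<longleftrightarrow> (\<forall>e1\<in>dedges K. \<forall>e2\<in>dedges K.
      e1 \<noteq> e2 \<and> dcol K e1 = dcol K e2 \<longrightarrow>
        dhead K e1 \<noteq> dhead K e2 \<and> dtail K e1 \<noteq> dtail K e2)"

text \<open>Fibre product over B_2.\<close>
definition fibre_product ::
  "('v1, 'e1, 'z1) bigraph_scheme \<Rightarrow> ('v2, 'e2, 'z2) bigraph_scheme
     \<Rightarrow> ('v1 \<times> 'v2, 'e1 \<times> 'e2) digraph" where
  "fibre_product K L =
     \<lparr> dverts = dverts K \<times> dverts L,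
       dedges = {(e1, e2). e1 \<in> dedges K \<and> e2 \<in> dedges L \<and> dcol K e1 = dcol L e2},
       dtail = (\<lambda>(e1, e2). (dtail K e1, dtail L e2)),
       dhead = (\<lambda>(e1, e2). (dhead K e1, dhead L e2)) \<rparr>"

text \<open>Undirected adjacency and connected components of the underlying undirected graph.\<close>
definition uadj :: "('v, 'e, 'z) digraph_scheme \<Rightarrow> ('v \<times> 'v) set" where
  "uadj G = {(dtail G e, dhead G e) | e. e \<in> dedges G}
          \<union> {(dhead G e, dtail G e) | e. e \<in> dedges G}"

definition components :: "('v, 'e, 'z) digraph_scheme \<Rightarrow> 'v set set" where
  "components G = dverts G // ((uadj G)\<^sup>*)"

text \<open>Edges of a component X (both endpoints lie in X since X is a component).\<close>
definition comp_edges :: "('v, 'e, 'z) digraph_scheme \<Rightarrow> 'v set \<Rightarrow> 'e set" where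
  "comp_edges G X = {e \<in> dedges G. dtail G e \<in> X \<and> dhead G e \<in> X}"

definition h1 :: "('v, 'e, 'z) digraph_scheme \<Rightarrow> 'v set \<Rightarrow> int" where
  "h1 G X = int (card (comp_edges G X)) - int (card X) + 1"

definition reduced_cyclicity :: "('v, 'e, 'z) digraph_scheme \<Rightarrow> int" where
  "reduced_cyclicity G = (\<Sum>X\<in>components G. max 0 (h1 G X - 1))"

end

theory Submission
  imports Defs
begin

text \<open>Mineyev's argument for the Hanna Neumann conjecture, in the finite graphs themselves. The
  edges of the universal cover of an etale bigraph carry a total order that depends only on the
  colours read along nonbacktracking paths; we use the order of Dicks and Sunic, which compares
  two edges by a sum of signs, one for each turn and for each inner edge of the path joining them.
  An edge is essential if some lift of it is the largest edge of a bi-infinite nonbacktracking path.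

  The reduced cyclicity is the number of essential edges. Indeed, in a component containing a
  cycle, let every vertex select its outgoing direction along which a nonbacktracking ray stays
  lowest. No edge is selected from both of its ends, and an edge is selected from neither end
  exactly when it is essential, so (edges) - (essential edges) = (vertices).

  Both projections of the fibre product preserve paths and colours, hence essential edges, and an
  edge of the fibre product is determined by its two projections.\<close>

declare split_paired_All [simp del] split_paired_Ex [simp del]

section \<open>Darts, signed costs and rays in an etale graph\<close>

locale etale_graph =
  fixes G :: "('v, 'e, 'z) digraph_scheme" and col :: "'e \<Rightarrow> nat"
  assumes digraph: "is_digraph G"
    and etale_head: "\<lbrakk>e \<in> dedges G; e' \<in> dedges G; col e = col e'; dhead G e = dhead G e'\<rbrakk> \<Longrightarrow> e = e'"
    and etale_tail: "\<lbrakk>e \<in> dedges G; e' \<in> dedges G; col e = col e'; dtail G e = dtail G e'\<rbrakk> \<Longrightarrow> e = e'"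
begin

text \<open>A dart \<open>(e, b)\<close> is the edge \<open>e\<close> traversed forwards (\<open>b = True\<close>) or backwards. Its label records
  colour and direction, so etaleness says that darts with the same source have distinct labels.\<close>

definition darts :: "('e \<times> bool) set" where
  "darts = dedges G \<times> UNIV"

definition src :: "'e \<times> bool \<Rightarrow> 'v" where
  "src d = (if snd d then dtail G (fst d) else dhead G (fst d))"

definition reverse :: "'e \<times> bool \<Rightarrow> 'e \<times> bool" where
  "reverse d = (fst d, \<not> snd d)"

definition label :: "'e \<times> bool \<Rightarrow> nat" where
  "label d = 2 * col (fst d) + of_bool (snd d)"

definition step :: "'e \<times> bool \<Rightarrow> 'e \<times> bool \<Rightarrow> bool" where
  "step d d' \<longleftrightarrow> d \<in> darts \<and> d' \<in> darts \<and> src d' = src (reverse d) \<and> d' \<noteq> reverse d"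

text \<open>Half of the sign sum of the Dicks-Sunic order: a forward edge counts \<open>1\<close> and a backward edge
  \<open>-1\<close>, a turn counts \<open>1\<close> or \<open>-1\<close> according to the order of the labels at the vertex. The predicate
  \<open>ray d m\<close> says that some infinite nonbacktracking path from \<open>d\<close> has all partial costs at most \<open>m\<close>.\<close>

definition cost :: "'e \<times> bool \<Rightarrow> 'e \<times> bool \<Rightarrow> int" where
  "cost d d' = of_bool (snd d) + of_bool (label (reverse d) < label d') - 1"

coinductive ray :: "'e \<times> bool \<Rightarrow> int \<Rightarrow> bool" where
  ray_step: "\<lbrakk>0 \<le> m; step d d'; ray d' (m - cost d d')\<rbrakk> \<Longrightarrow> ray d m"

text \<open>With this cost, all later edges of a path \<open>d\<close>, \<open>d'\<close>, ... are below \<open>d\<close> iff the label of \<open>d'\<close> is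
  less than that of \<open>reverse d\<close> and the path from \<open>d'\<close> on has all partial costs at most \<open>0\<close>.\<close>

definition essential :: "'e \<Rightarrow> bool" where
  "essential e \<longleftrightarrow> e \<in> dedges G \<and>
     (\<forall>b. \<exists>d. src d = src (e, b) \<and> label d < label (e, b) \<and> ray d 0)"

lemma finite_darts: "finite darts"
  using digraph by (simp add: darts_def is_digraph_def)

lemma fst_rev [simp]: "fst (reverse d) = fst d"
  and snd_rev [simp]: "snd (reverse d) \<longleftrightarrow> \<not> snd d"
  and rev_rev [simp]: "reverse (reverse d) = d"
  and rev_neq [simp]: "reverse d \<noteq> d"
  and rev_in_darts [simp]: "reverse d \<in> darts \<longleftrightarrow> d \<in> darts"
  by (cases d; simp add: reverse_def darts_def)+

lemma fst_eq_cases: "fst d = fst d' \<Longrightarrow> d' = d \<or> d' = reverse d"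
  by (cases d; cases d') (auto simp: reverse_def)

lemma label_eqD:
  assumes "label d = label d'"
  shows "col (fst d) = col (fst d')" "snd d = snd d'"
proof -
  have "label d div 2 = label d' div 2" "odd (label d) = odd (label d')"
    using assms by simp_all
  then show "col (fst d) = col (fst d')" "snd d = snd d'"
    by (simp_all add: label_def split: if_splits)
qed

lemma label_inj:
  assumes "d \<in> darts" "d' \<in> darts" "src d = src d'" "label d = label d'"
  shows "d = d'"
proof -
  note l = label_eqD[OF assms(4)]
  have "fst d = fst d'"
    using assms(1-3) l etale_head[of "fst d" "fst d'"] etale_tail[of "fst d" "fst d'"]
    by (auto simp: darts_def src_def split: if_splits)
  with l show ?thesis by (simp add: prod_eq_iff)
qed

lemma step_rev: "step d d' \<Longrightarrow> step (reverse d') (reverse d)"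
  by (auto simp: step_def)

text \<open>By etaleness the two labels at the turn differ, so exactly one of the two directions
  counts the turn. The remaining difference of directions telescopes along a walk and vanishes on a
  closed one.\<close>

lemma cost_rev:
  assumes "step d d'"
  shows "cost (reverse d') (reverse d) = of_bool (snd d) - of_bool (snd d') - cost d d'"
proof -
  have "label (reverse d) \<noteq> label d'"
    using assms label_inj[of "reverse d" d'] by (auto simp: step_def)
  then show ?thesis by (auto simp: cost_def)
qed

lemma ray_mono: "ray d m \<Longrightarrow> m \<le> n \<Longrightarrow> ray d n"
proof (coinduction arbitrary: d m n)
  case ray
  from \<open>ray d m\<close> obtain d' where "0 \<le> m" "step d d'" "ray d' (m - cost d d')"
    by cases
  with ray show ?case by (intro exI[of _ n] exI[of _ d] exI[of _ d']) auto
qed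

lemma ray_nonneg: "ray d m \<Longrightarrow> 0 \<le> m"
  by (erule ray.cases) simp

lemma ray_dart: "ray d m \<Longrightarrow> d \<in> darts"
  by (erule ray.cases) (simp add: step_def)

lemma ray_Cons: "step d d' \<Longrightarrow> ray d' m \<Longrightarrow> ray d (max 0 (cost d d' + m))"
  by (rule ray_step[of _ d d']) (auto elim: ray_mono)

section \<open>Finite walks, their reversal, and rays obtained from closed walks\<close>

text \<open>Finite counterpart of \<open>ray\<close>: \<open>s\<close> is the total cost from
  \<open>d\<close> to \<open>d'\<close>, and \<open>m\<close> bounds all partial costs.\<close>

inductive walk :: "'e \<times> bool \<Rightarrow> 'e \<times> bool \<Rightarrow> int \<Rightarrow> int \<Rightarrow> bool" where
  walk_Nil: "0 \<le> m \<Longrightarrow> walk d d 0 m"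
| walk_Cons: "\<lbrakk>0 \<le> m; step d d1; walk d1 d' s (m - cost d d1)\<rbrakk> \<Longrightarrow> walk d d' (cost d d1 + s) m"

lemma walk_mono: "walk d d' s m \<Longrightarrow> m \<le> n \<Longrightarrow> walk d d' s n"
proof (induction arbitrary: n rule: walk.induct)
  case (walk_Cons m d d1 d' s)
  then show ?case by (intro walk.walk_Cons) auto
qed (auto intro: walk_Nil)

lemma walk_Cons': "step d d1 \<Longrightarrow> walk d1 d' s m \<Longrightarrow> walk d d' (cost d d1 + s) (max 0 (cost d d1 + m))"
  by (rule walk_Cons) (auto elim: walk_mono)

lemma walk_snoc:
  "walk d d' s m \<Longrightarrow> step d' d'' \<Longrightarrow> \<exists>m'. walk d d'' (s + cost d' d'') m'"
proof (induction rule: walk.induct)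
  case (walk_Nil m d)
  then show ?case
    using walk_Cons'[of d d'' d'' 0 0] by (auto intro: walk.walk_Nil)
next
  case (walk_Cons m d d1 d' s)
  then show ?case
    using walk_Cons'[of d d1 d'' "s + cost d' d''"] by (auto simp: add.assoc)
qed

lemma walk_rev:
  "walk d d' s m \<Longrightarrow> \<exists>m'. walk (reverse d') (reverse d) (of_bool (snd d) - of_bool (snd d') - s) m'"
proof (induction rule: walk.induct)
  case (walk_Nil m d)
  then show ?case by (auto intro: walk.walk_Nil)
next
  case (walk_Cons m d d1 d' s)
  then obtain m' where "walk (reverse d') (reverse d1) (of_bool (snd d1) - of_bool (snd d') - s) m'"
    by blast
  from walk_snoc[OF this step_rev[OF walk_Cons.hyps(2)]]
  show ?case by (simp add: cost_rev[OF walk_Cons.hyps(2)] algebra_simps)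
qed

lemma rtrancl_walk: "step\<^sup>*\<^sup>* d d' \<Longrightarrow> \<exists>s m. walk d d' s m"
proof (induction rule: rtranclp_induct)
  case base
  show ?case using walk_Nil[of 0 d] by blast
next
  case (step d' d'')
  then show ?case using walk_snoc by blast
qed

lemma ray_of_cycle:
  assumes st: "step d d1" and w: "walk d1 d s m" and le: "cost d d1 + s \<le> 0"
  shows "ray d (max 0 (cost d d1 + m))"
proof -
  define M where "M = max 0 (cost d d1 + m)"
  \<comment> \<open>Coinduction invariant: the rest of the current lap fits the budget
    \<open>n\<close> and leaves at least \<open>M\<close> on return to \<open>d\<close>. A full lap
    costs at most 0, so the invariant survives each new lap.\<close>
  have "ray x n" if "\<exists>r. walk x d r n \<and> M \<le> n - r" for x n
    using that
  proof (coinduction arbitrary: x n)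
    case ray
    then obtain r where r: "walk x d r n" "M \<le> n - r" by blast
    then show ?case
    proof cases
      case walk_Nil
      have "walk d1 d s (n - cost d d1)"
        using w by (rule walk_mono) (use walk_Nil r in \<open>auto simp: M_def\<close>)
      then show ?thesis
        using walk_Nil r st le
        by (intro exI[of _ n] exI[of _ x] exI[of _ d1]) auto
    next
      case (walk_Cons x1 s')
      then show ?thesis using r
        by (intro exI[of _ n] exI[of _ x] exI[of _ x1]) auto
    qed
  qed
  moreover have "walk d d 0 M" by (rule walk_Nil) (simp add: M_def)
  ultimately have "ray d M" by (metis diff_zero order_refl)
  then show ?thesis by (simp add: M_def)
qed

text \<open>The total cost of a closed walk changes sign under reversal, so one of the two directions
  can be repeated forever at bounded cost.\<close>

lemma cycle_bounded:
  assumes "step\<^sup>+\<^sup>+ d d"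
  shows "\<exists>d' m. fst d' \<in> fst ` {x. step\<^sup>*\<^sup>* d x} \<and> ray d' m"
proof -
  obtain d1 where d1: "step d d1" "step\<^sup>*\<^sup>* d1 d"
    using assms by (meson tranclpD)
  obtain s m where w: "walk d1 d s m" using rtrancl_walk[OF d1(2)] by blast
  obtain m' where w': "walk (reverse d) (reverse d1) (of_bool (snd d1) - of_bool (snd d) - s) m'"
    using walk_rev[OF w] by blast
  show ?thesis
  proof (cases "cost d d1 + s \<le> 0")
    case True
    from ray_of_cycle[OF d1(1) w this] show ?thesis by blast
  next
    case False
    have "ray (reverse d1) (max 0 (cost (reverse d1) (reverse d) + m'))"
      by (rule ray_of_cycle[OF step_rev[OF d1(1)] w'])
        (use False in \<open>simp add: cost_rev[OF d1(1)]\<close>)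
    moreover have "fst (reverse d1) \<in> fst ` {x. step\<^sup>*\<^sup>* d x}" using d1(1) by auto
    ultimately show ?thesis by blast
  qed
qed

text \<open>Each edge is oriented in the direction from which fewer darts can be reached, and is
  sent to the vertex it then points to; acyclicity makes this map injective.\<close>

lemma acyclic_card_le:
  assumes "finite W" "F \<subseteq> dedges G"
    and ends: "\<And>d. fst d \<in> F \<Longrightarrow> src d \<in> W"
    and acyc: "\<And>d. fst d \<in> F \<Longrightarrow> \<not> step\<^sup>+\<^sup>+ d d"
  shows "card F \<le> card W"
proof -
  define dep where "dep d = card {x. step\<^sup>*\<^sup>* d x}" for d
  have fin: "finite {x. step\<^sup>*\<^sup>* d x}" for d
  proof (rule finite_subset)
    show "{x. step\<^sup>*\<^sup>* d x} \<subseteq> insert d darts"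
      by (auto elim: rtranclp.cases simp: step_def)
  qed (simp add: finite_darts)
  have dep_less: "dep d' < dep d" if "step d d'" "fst d \<in> F" for d d'
    unfolding dep_def
  proof (rule psubset_card_mono[OF fin])
    have "\<not> step\<^sup>*\<^sup>* d' d"
      using acyc[OF that(2)] that(1) by (meson rtranclp_into_tranclp2)
    then show "{x. step\<^sup>*\<^sup>* d' x} \<subset> {x. step\<^sup>*\<^sup>* d x}"
      using that(1) by (auto intro: converse_rtranclp_into_rtranclp)
  qed
  define down where "down e = (e, dep (e, True) \<le> dep (e, False))" for e
  have down: "dep (down e) \<le> dep (reverse (down e))" for e
    by (cases "dep (e, True) \<le> dep (e, False)") (auto simp: down_def reverse_def)
  have fst_down [simp]: "fst (down e) = e" for e by (simp add: down_def)
  \<comment> \<open>If \<open>d\<close> and \<open>d'\<close> end at the same vertex, \<open>d\<close> continues along the reverse of \<open>d'\<close> and vice versa,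
    so their depths would increase around a cycle of four.\<close>
  have "inj_on (\<lambda>e. src (reverse (down e))) F"
  proof (rule inj_onI, rule ccontr)
    fix e f assume ef: "e \<in> F" "f \<in> F" "src (reverse (down e)) = src (reverse (down f))" "e \<noteq> f"
    have "step (down e) (reverse (down f))" "step (down f) (reverse (down e))"
      using ef \<open>F \<subseteq> _\<close> by (auto simp: step_def darts_def down_def reverse_def)
    then have "dep (reverse (down f)) < dep (down e)" "dep (reverse (down e)) < dep (down f)"
      using dep_less ef by auto
    then show False using down[of e] down[of f] by linarith
  qed
  moreover have "(\<lambda>e. src (reverse (down e))) ` F \<subseteq> W"
    by (intro image_subsetI ends) simp
  ultimately show ?thesis using \<open>finite W\<close> by (rule card_inj_on_le)
qed

section \<open>Levels and the selected dart at a vertex\<close>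

definition bounded :: "'e \<times> bool \<Rightarrow> bool" where
  "bounded d \<longleftrightarrow> (\<exists>m. ray d m)"

text \<open>For a bounded dart, level 0 means that some ray never rises above its start. For other
  darts the value is arbitrary.\<close>

definition level :: "'e \<times> bool \<Rightarrow> nat" where
  "level d = (LEAST n. ray d (int n))"

text \<open>Ties in level are broken by label, which is injective on the darts at a vertex, so a
  vertex with a bounded dart has a lowest one.\<close>

definition lower :: "'e \<times> bool \<Rightarrow> 'e \<times> bool \<Rightarrow> bool" where
  "lower d d' \<longleftrightarrow> level d < level d' \<or> level d = level d' \<and> label d < label d'"

definition selected :: "'e \<times> bool \<Rightarrow> bool" where
  "selected d \<longleftrightarrow> bounded d \<and>
     (\<forall>d'. bounded d' \<and> src d' = src d \<and> d' \<noteq> d \<longrightarrow> lower d d')"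

lemma selected_bounded: "selected d \<Longrightarrow> bounded d"
  by (simp add: selected_def)

lemma selected_lower:
  "\<lbrakk>selected d; bounded d'; src d' = src d; d' \<noteq> d\<rbrakk> \<Longrightarrow> lower d d'"
  unfolding selected_def by blast

lemma bounded_dart: "bounded d \<Longrightarrow> d \<in> darts"
  by (auto simp: bounded_def ray_dart)

lemma ray_level:
  assumes "bounded d"
  shows "ray d (int (level d))"
proof -
  obtain m where "ray d m" using assms by (auto simp: bounded_def)
  then have "ray d (int (nat m))" by (rule ray_mono) simp
  then show ?thesis unfolding level_def by (rule LeastI)
qed

lemma level_le:
  assumes "ray d m"
  shows "int (level d) \<le> m"
proof -
  have "ray d (int (nat m))" using assms by (rule ray_mono) simp
  then have "level d \<le> nat m" unfolding level_def by (rule Least_le)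
  with ray_nonneg[OF assms] show ?thesis by linarith
qed

text \<open>Together with \<open>level_step_ge\<close> this is a shortest-path recursion:
  \<open>level d\<close> is the minimum of \<open>cost d d' + level d'\<close> over the steps to
  bounded \<open>d'\<close>, cut off below at 0.\<close>

lemma level_step_le:
  assumes "step d d'" "bounded d'"
  shows "bounded d" "int (level d) \<le> max 0 (cost d d' + int (level d'))"
proof -
  note r = ray_Cons[OF assms(1) ray_level[OF assms(2)]]
  show "bounded d" unfolding bounded_def using r by blast
  show "int (level d) \<le> max 0 (cost d d' + int (level d'))" using r by (rule level_le)
qed

lemma level_step_ge:
  assumes "bounded d"
  obtains d' where "step d d'" "bounded d'" "cost d d' + int (level d') \<le> int (level d)"
proof -
  from ray_level[OF assms] obtain d' where
    d': "step d d'" "ray d' (int (level d) - cost d d')" by cases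
  show thesis
  proof (rule that[OF d'(1)])
    show "bounded d'" unfolding bounded_def using d'(2) by blast
    show "cost d d' + int (level d') \<le> int (level d)" using level_le[OF d'(2)] by simp
  qed
qed

lemma selected_exists:
  assumes "bounded d"
  obtains x where "selected x" "src x = src d"
proof -
  let ?P = "\<lambda>x. bounded x \<and> src x = src d"
  obtain y where y: "?P y" "\<And>z. ?P z \<Longrightarrow> level y \<le> level z"
    using ex_has_least_nat[of ?P d level] assms by blast
  let ?Q = "\<lambda>x. ?P x \<and> level x = level y"
  obtain x where x: "?Q x" "\<And>z. ?Q z \<Longrightarrow> label x \<le> label z"
    using ex_has_least_nat[of ?Q y label] y by blast
  have "lower x z" if "?P z" "z \<noteq> x" for z
  proof -
    have "label x \<noteq> label z"
      using that x(1) label_inj[of x z] by (auto simp: bounded_dart)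
    then show ?thesis
      using y(2)[of z] x(1) x(2)[of z] that by (cases "level z = level y") (auto simp: lower_def)
  qed
  then show thesis using x(1) by (intro that[of x]) (auto simp: selected_def)
qed

lemma selected_unique:
  assumes "selected d" "selected d'" "src d = src d'"
  shows "d = d'"
proof (rule ccontr)
  assume "d \<noteq> d'"
  then have "lower d d'" "lower d' d"
    using assms by (auto intro!: selected_lower simp: selected_bounded)
  then show False by (auto simp: lower_def)
qed

text \<open>A ray with bound 0 has the least possible level, so its smaller label rules out
  \<open>d\<close>.\<close>

lemma essential_not_selected:
  assumes "essential (fst d)"
  shows "\<not> selected d"
proof
  assume sel: "selected d"
  obtain d' where d': "src d' = src d" "label d' < label d" "ray d' 0"
    using assms unfolding essential_def by (metis prod.collapse)
  then have "lower d d'" by (intro selected_lower[OF sel]) (auto simp: bounded_def)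
  moreover have "level d' = 0" using level_le[OF d'(3)] by simp
  ultimately show False using d'(2) by (simp add: lower_def)
qed

text \<open>For a dart selected together with its reverse, applying the next lemma in both directions
  gives a sum of level differences that is \<open>0\<close> and at least \<open>1\<close>.\<close>

lemma selected_level_rev:
  assumes "selected d" "selected (reverse d)"
  shows "int (level (reverse d)) + of_bool (snd d) \<le> int (level d)"
proof -
  obtain x where x: "step d x" "bounded x" "cost d x + int (level x) \<le> int (level d)"
    using level_step_ge[OF selected_bounded[OF assms(1)]] by blast
  then have "lower (reverse d) x" by (intro selected_lower[OF assms(2)]) (auto simp: step_def)
  \<comment> \<open>Equal levels force the turn indicator in \<open>cost d x\<close> to be 1;
    otherwise the gap in levels makes up for it.\<close>
  then show ?thesis using x(3) by (auto simp: lower_def cost_def of_bool_def split: if_splits)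
qed

lemma selected_rev: "selected d \<Longrightarrow> \<not> selected (reverse d)"
  using selected_level_rev[of d] selected_level_rev[of "reverse d"] by (auto simp: of_bool_def split: if_splits)

text \<open>A path along \<open>d\<close> can continue along \<open>x\<close>, and \<open>x\<close>
  beats \<open>reverse d\<close>: on a tie of levels the turn indicator in \<open>cost d x\<close>
  is 0, otherwise the gap in levels pays for it.\<close>

lemma not_selected_level_rev:
  assumes d: "d \<in> darts" and x: "selected x" "src x = src (reverse d)" "x \<noteq> reverse d"
  shows "bounded d" "bounded (reverse d) \<Longrightarrow> int (level d) \<le> max 0 (int (level (reverse d)) - of_bool (\<not> snd d))"
proof -
  have st: "step d x" using d x by (auto simp: step_def bounded_dart selected_def)
  have bx: "bounded x" using x by (simp add: selected_def)
  show "bounded d" using level_step_le[OF st bx] by simp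
  assume "bounded (reverse d)"
  then have "lower x (reverse d)" using x by (intro selected_lower) auto
  then show "int (level d) \<le> max 0 (int (level (reverse d)) - of_bool (\<not> snd d))"
    using level_step_le(2)[OF st bx]
    by (auto simp: lower_def cost_def of_bool_def split: if_splits)
qed

lemma not_selected_essential:
  assumes d: "d \<in> darts"
    and x: "selected x" "src x = src (reverse d)" "x \<noteq> reverse d"
    and y: "selected y" "src y = src d" "y \<noteq> d"
  shows "essential (fst d)"
proof -
  note X = not_selected_level_rev[OF d x]
  have d': "reverse d \<in> darts" and y': "src y = src (reverse (reverse d))" "y \<noteq> reverse (reverse d)"
    using d y by simp_all
  note Y = not_selected_level_rev[OF d' y(1) y']
  \<comment> \<open>Exactly one of \<open>d\<close> and \<open>reverse d\<close> is forward, so one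
    of the two bounds subtracts 1, and neither level can be positive.\<close>
  have "level d = 0" "level (reverse d) = 0"
    using X(2)[OF Y(1)] Y(2) X(1) by (auto simp: of_bool_def split: if_splits)
  moreover have "lower x (reverse d)" "lower y d"
    using x y X(1) Y(1) by (auto intro!: selected_lower)
  \<comment> \<open>Nothing lies below level 0, so \<open>x\<close> and \<open>y\<close> win by
    their labels.\<close>
  ultimately have lev: "level x = 0" "level y = 0"
    and lab: "label x < label (reverse d)" "label y < label d" by (auto simp: lower_def)
  have "ray x 0" "ray y 0"
    using ray_level[of x] ray_level[of y] lev x(1) y(1) by (auto simp: selected_def)
  then have "\<exists>z. src z = src w \<and> label z < label w \<and> ray z 0" if "w = d \<or> w = reverse d" for w
    using that x(2) y(2) lab by blast
  moreover have "(fst d, b) = d \<or> (fst d, b) = reverse d" for b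
    by (metis fst_conv fst_eq_cases)
  ultimately show ?thesis using d unfolding essential_def by (auto simp: darts_def)
qed

section \<open>Connected components and the count of essential edges\<close>

lemma bounded_step:
  assumes "bounded d" "d' \<in> darts" "src d' = src d"
  shows "\<exists>x. bounded x \<and> src x = src (reverse d')"
proof (cases "d = d'")
  case True
  obtain x where "step d x" "bounded x" using level_step_ge[OF assms(1)] by blast
  with True show ?thesis by (auto simp: step_def)
next
  case False
  \<comment> \<open>The ray from \<open>d\<close> leaves along another dart than \<open>d'\<close>,
    so \<open>reverse d'\<close> can be put in front of it without backtracking.\<close>
  then have "step (reverse d') d"
    using assms bounded_dart[OF assms(1)] by (auto simp: step_def)
  then show ?thesis using level_step_le(1) assms(1) by blast
qed

lemma uadj_dart: "(v, w) \<in> uadj G \<longleftrightarrow> (\<exists>d\<in>darts. src d = v \<and> src (reverse d) = w)"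
proof -
  have "(v, w) \<in> uadj G \<longleftrightarrow> (\<exists>e\<in>dedges G. \<exists>b. src (e, b) = v \<and> src (reverse (e, b)) = w)"
    by (auto simp: uadj_def src_def ex_bool_eq)
  also have "\<dots> \<longleftrightarrow> (\<exists>d\<in>darts. src d = v \<and> src (reverse d) = w)"
    by (simp add: darts_def Bex_def split_paired_Ex)
  finally show ?thesis .
qed

lemma equiv_uadj: "equiv UNIV ((uadj G)\<^sup>*)"
proof -
  have "sym (uadj G)" by (auto simp: sym_def uadj_def)
  then show ?thesis by (simp add: equiv_def refl_rtrancl trans_rtrancl sym_rtrancl)
qed

lemma bounded_connected:
  assumes "(v, w) \<in> (uadj G)\<^sup>*" "\<exists>d. bounded d \<and> src d = v"
  shows "\<exists>d. bounded d \<and> src d = w"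
  using assms
proof (induction rule: rtrancl_induct)
  case (step y z)
  then obtain d d' where "bounded d" "src d = y" "d' \<in> darts" "src d' = y" "src (reverse d') = z"
    by (auto simp: uadj_dart)
  then show ?case using bounded_step[of d d'] by auto
qed

context
  fixes X assumes X: "X \<in> components G"
begin

lemma component_subset: "X \<subseteq> dverts G"
proof -
  obtain v where v: "v \<in> dverts G" "X = (uadj G)\<^sup>* `` {v}"
    using X by (auto simp: components_def quotient_def)
  have "w \<in> dverts G" if "(v, w) \<in> (uadj G)\<^sup>*" for w
    using that v(1) digraph by (induction) (auto simp: uadj_def is_digraph_def)
  with v(2) show ?thesis by auto
qed

lemma component_finite: "finite X"
  using component_subset digraph by (auto simp: is_digraph_def intro: finite_subset)

lemma component_closed: "v \<in> X \<Longrightarrow> (v, w) \<in> (uadj G)\<^sup>* \<Longrightarrow> w \<in> X"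
  using X by (auto simp: components_def quotient_def)

lemma component_connected:
  assumes "v \<in> X" "w \<in> X"
  shows "(v, w) \<in> (uadj G)\<^sup>*"
proof -
  have "X \<in> UNIV // (uadj G)\<^sup>*" using X by (auto simp: components_def quotient_def)
  from quotient_eq_iff[OF equiv_uadj this this assms] show ?thesis by simp
qed

lemma dart_component:
  assumes "d \<in> darts" "src d \<in> X"
  shows "fst d \<in> comp_edges G X"
proof -
  have "(src d, src (reverse d)) \<in> uadj G" using assms by (auto simp: uadj_dart)
  then have "src (reverse d) \<in> X" using component_closed assms(2) by blast
  with assms show ?thesis
    by (auto simp: comp_edges_def darts_def src_def split: if_splits)
qed

lemma comp_edges_src: "fst d \<in> comp_edges G X \<Longrightarrow> d \<in> darts \<and> src d \<in> X"
  by (cases d) (auto simp: comp_edges_def src_def darts_def)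

lemma card_component_bounded:
  assumes "v \<in> X" "bounded d" "src d = v"
  shows "card (comp_edges G X) = card X + card {e \<in> comp_edges G X. essential e}"
proof -
  have bd: "\<exists>x. selected x \<and> src x = w" if w: "w \<in> X" for w
  proof -
    obtain x where "bounded x" "src x = w"
      using bounded_connected[OF component_connected[OF assms(1) w]] assms(2,3) by blast
    with selected_exists[of x] show ?thesis by metis
  qed
  \<comment> \<open>\<open>S\<close> links the two counts: \<open>src\<close> maps it bijectively
    onto the vertices, \<open>fst\<close> onto the inessential edges.\<close>
  define S where "S = {x. selected x \<and> src x \<in> X}"
  have S_darts: "x \<in> darts" if "x \<in> S" for x
    using that by (simp add: S_def selected_def bounded_dart)
  have "bij_betw src S X"
  proof (rule bij_betw_imageI)
    show "inj_on src S" by (rule inj_onI) (simp add: S_def selected_unique)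
    show "src ` S = X"
    proof
      show "X \<subseteq> src ` S"
      proof
        fix w assume "w \<in> X"
        with bd obtain x where "selected x" "src x = w" by blast
        with \<open>w \<in> X\<close> show "w \<in> src ` S" by (auto simp: S_def)
      qed
    qed (auto simp: S_def)
  qed
  then have "card S = card X" by (rule bij_betw_same_card)
  moreover have "bij_betw fst S {e \<in> comp_edges G X. \<not> essential e}"
  proof (rule bij_betw_imageI)
    show "inj_on fst S"
    proof (rule inj_onI)
      fix x y assume "x \<in> S" "y \<in> S" "fst x = fst y"
      then show "x = y" using fst_eq_cases[of x y] selected_rev[of x] by (auto simp: S_def)
    qed
    have "e \<in> fst ` S" if e: "e \<in> comp_edges G X" "\<not> essential e" for e
    proof -
      let ?d = "(e, True)"
      have in_X: "?d \<in> darts" "src ?d \<in> X" "src (reverse ?d) \<in> X"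
        using comp_edges_src[of ?d] comp_edges_src[of "reverse ?d"] e(1) by auto
      obtain x y where "selected x" "src x = src (reverse ?d)" "selected y" "src y = src ?d"
        using bd[OF in_X(2)] bd[OF in_X(3)] by blast
      moreover from this have "x = reverse ?d \<or> y = ?d"
        using not_selected_essential[OF in_X(1), of x y] e(2) by auto
      ultimately have "reverse ?d \<in> S \<or> ?d \<in> S" using in_X by (auto simp: S_def)
      then show ?thesis using fst_rev[of ?d] by (metis fst_conv imageI)
    qed
    moreover have "fst x \<in> comp_edges G X \<and> \<not> essential (fst x)" if "x \<in> S" for x
      using dart_component[OF S_darts[OF that]] essential_not_selected[of x] that
      by (auto simp: S_def)
    ultimately show "fst ` S = {e \<in> comp_edges G X. \<not> essential e}"
      by (intro equalityI subsetI) (auto simp only: mem_Collect_eq image_iff)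
  qed
  then have "card S = card {e \<in> comp_edges G X. \<not> essential e}" by (rule bij_betw_same_card)
  moreover have "finite (comp_edges G X)"
    using digraph by (simp add: is_digraph_def comp_edges_def)
  then have "card (comp_edges G X) =
      card {e \<in> comp_edges G X. \<not> essential e} + card {e \<in> comp_edges G X. essential e}"
    by (subst card_Un_disjoint[symmetric]) (auto intro: arg_cong[of _ _ card])
  ultimately show ?thesis by simp
qed

text \<open>By \<open>cycle_bounded\<close>, a closed nonbacktracking walk would yield a bounded
  dart in the component, so \<open>acyclic_card_le\<close> applies.\<close>

lemma card_component_unbounded:
  assumes "\<And>d. src d \<in> X \<Longrightarrow> \<not> bounded d"
  shows "card (comp_edges G X) \<le> card X" "{e \<in> comp_edges G X. essential e} = {}"
proof -
  show "card (comp_edges G X) \<le> card X"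
  proof (rule acyclic_card_le[OF component_finite])
    fix d :: "'e \<times> bool" assume d: "fst d \<in> comp_edges G X"
    have reach: "fst x \<in> comp_edges G X" if "step\<^sup>*\<^sup>* d x" for x
      using that
    proof induction
      case (step x y)
      then show ?case
        using comp_edges_src[of "reverse x"] by (intro dart_component) (auto simp: step_def)
    qed (rule d)
    show "\<not> step\<^sup>+\<^sup>+ d d"
    proof
      assume "step\<^sup>+\<^sup>+ d d"
      from cycle_bounded[OF this] obtain d' m where "fst d' \<in> comp_edges G X" "ray d' m"
        using reach by (metis imageE mem_Collect_eq)
      then show False using comp_edges_src[of d'] assms by (auto simp: bounded_def)
    qed
    show "src d \<in> X" using comp_edges_src[OF d] by simp
  qed (auto simp: comp_edges_def)
  have "\<not> essential e" if e: "e \<in> comp_edges G X" for e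
  proof
    assume "essential e"
    then obtain d where "src d = src (e, True)" "ray d 0"
      unfolding essential_def by blast
    then show False using comp_edges_src[of "(e, True)"] e assms by (auto simp: bounded_def)
  qed
  then show "{e \<in> comp_edges G X. essential e} = {}" by auto
qed

lemma component_reduced_cyclicity:
  "max 0 (h1 G X - 1) = int (card {e \<in> comp_edges G X. essential e})"
proof (cases "\<exists>d. src d \<in> X \<and> bounded d")
  case True
  then obtain d where "src d \<in> X" "bounded d" by blast
  from card_component_bounded[OF this refl] show ?thesis by (simp add: h1_def)
next
  case False
  then have "\<And>d. src d \<in> X \<Longrightarrow> \<not> bounded d" by blast
  from card_component_unbounded[OF this] show ?thesis by (simp only: h1_def card.empty) simp
qed

end

theorem reduced_cyclicity_eq_card_essential:
  "reduced_cyclicity G = int (card {e. essential e})"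
proof -
  have fin: "finite (dverts G)" "finite (dedges G)" using digraph by (auto simp: is_digraph_def)
  have "{e. essential e} = (\<Union>X\<in>components G. {e \<in> comp_edges G X. essential e})"
  proof -
    have "\<exists>X\<in>components G. e \<in> comp_edges G X" if "e \<in> dedges G" for e
    proof -
      let ?X = "(uadj G)\<^sup>* `` {dtail G e}"
      have "?X \<in> components G"
        using digraph that by (auto simp: components_def is_digraph_def intro: quotientI)
      moreover have "(dtail G e, dhead G e) \<in> uadj G" using that by (auto simp: uadj_def)
      then have "e \<in> comp_edges G ?X" using that by (auto simp: comp_edges_def)
      ultimately show ?thesis by blast
    qed
    then show ?thesis by (auto simp: essential_def)
  qed
  also have "card \<dots> = (\<Sum>X\<in>components G. card {e \<in> comp_edges G X. essential e})"
  proof (rule card_UN_disjoint)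
    show "finite (components G)"
      using fin by (simp add: components_def quotient_def)
    show "\<forall>X\<in>components G. finite {e \<in> comp_edges G X. essential e}"
      using fin by (auto simp: comp_edges_def)
    show "\<forall>X\<in>components G. \<forall>Y\<in>components G. X \<noteq> Y \<longrightarrow>
      {e \<in> comp_edges G X. essential e} \<inter> {e \<in> comp_edges G Y. essential e} = {}"
    proof (intro ballI impI)
      fix X Y assume XY: "X \<in> components G" "Y \<in> components G" "X \<noteq> Y"
      then have "X \<in> UNIV // (uadj G)\<^sup>*" "Y \<in> UNIV // (uadj G)\<^sup>*"
        by (auto simp: components_def quotient_def)
      from quotient_disj[OF equiv_uadj this] XY(3) have "X \<inter> Y = {}" by blast
      then show "{e \<in> comp_edges G X. essential e} \<inter> {e \<in> comp_edges G Y. essential e} = {}"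
        by (auto simp: comp_edges_def)
    qed
  qed
  finally show ?thesis
    by (simp add: reduced_cyclicity_def component_reduced_cyclicity)
qed

end

section \<open>Colour-preserving morphisms of etale graphs\<close>

locale etale_morphism =
  P: etale_graph P colP + Q: etale_graph Q colQ
  for P :: "('v, 'e, 'z) digraph_scheme" and colP :: "'e \<Rightarrow> nat"
    and Q :: "('w, 'f, 'y) digraph_scheme" and colQ :: "'f \<Rightarrow> nat" +
  fixes \<phi> :: "'e \<Rightarrow> 'f" and \<psi> :: "'v \<Rightarrow> 'w"
  assumes edge: "e \<in> dedges P \<Longrightarrow> \<phi> e \<in> dedges Q"
    and tail: "e \<in> dedges P \<Longrightarrow> dtail Q (\<phi> e) = \<psi> (dtail P e)"
    and head: "e \<in> dedges P \<Longrightarrow> dhead Q (\<phi> e) = \<psi> (dhead P e)"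
    and colour: "e \<in> dedges P \<Longrightarrow> colQ (\<phi> e) = colP e"
begin

abbreviation lift :: "'e \<times> bool \<Rightarrow> 'f \<times> bool" where
  "lift \<equiv> map_prod \<phi> id"

lemma lift_dart: "d \<in> P.darts \<Longrightarrow> lift d \<in> Q.darts"
  by (auto simp: P.darts_def Q.darts_def edge)

lemma lift_src: "d \<in> P.darts \<Longrightarrow> Q.src (lift d) = \<psi> (P.src d)"
  by (auto simp: P.darts_def P.src_def Q.src_def tail head)

lemma lift_rev: "lift (P.reverse d) = Q.reverse (lift d)"
  by (cases d) (simp add: P.reverse_def Q.reverse_def)

lemma lift_label: "d \<in> P.darts \<Longrightarrow> Q.label (lift d) = P.label d"
  by (auto simp: P.darts_def P.label_def Q.label_def colour)

lemma lift_cost: "P.step d d' \<Longrightarrow> Q.cost (lift d) (lift d') = P.cost d d'"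
  using lift_label[of d'] lift_label[of "P.reverse d"]
  by (cases d) (simp add: P.step_def P.cost_def Q.cost_def lift_rev)

text \<open>The image path cannot backtrack: distinct darts at a vertex of \<open>P\<close> have
  distinct labels, and labels are preserved.\<close>

lemma lift_step:
  assumes "P.step d d'"
  shows "Q.step (lift d) (lift d')"
proof -
  have d: "d \<in> P.darts" "d' \<in> P.darts" "P.src d' = P.src (P.reverse d)" "d' \<noteq> P.reverse d"
    using assms by (auto simp: P.step_def)
  then have "P.label d' \<noteq> P.label (P.reverse d)"
    using P.label_inj[of d' "P.reverse d"] by auto
  then have "lift d' \<noteq> lift (P.reverse d)"
    using d lift_label[of d'] lift_label[of "P.reverse d"] by auto
  with d show ?thesis
    by (auto simp: Q.step_def lift_dart lift_src simp flip: lift_rev)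
qed

lemma lift_ray: "P.ray d m \<Longrightarrow> Q.ray (lift d) m"
proof (coinduction arbitrary: d m)
  case ray
  then obtain d' where "0 \<le> m" "P.step d d'" "P.ray d' (m - P.cost d d')"
    by cases
  then show ?case
    by (intro exI[of _ m] exI[of _ "lift d"] exI[of _ "lift d'"]) (auto simp: lift_step lift_cost)
qed

lemma lift_essential:
  assumes "P.essential e"
  shows "Q.essential (\<phi> e)"
  unfolding Q.essential_def
proof (intro conjI allI)
  have e: "e \<in> dedges P" using assms by (simp add: P.essential_def)
  then show "\<phi> e \<in> dedges Q" by (rule edge)
  fix b
  have eb: "lift (e, b) = (\<phi> e, b)" "(e, b) \<in> P.darts" using e by (auto simp: P.darts_def)
  obtain d where d: "P.src d = P.src (e, b)" "P.label d < P.label (e, b)" "P.ray d 0"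
    using assms unfolding P.essential_def by blast
  have "Q.src (lift d) = Q.src (lift (e, b))"
    using d eb(2) P.ray_dart[OF d(3)] by (simp only: lift_src)
  moreover have "Q.label (lift d) < Q.label (lift (e, b))"
    using d eb(2) P.ray_dart[OF d(3)] by (simp only: lift_label)
  ultimately show "\<exists>d. Q.src d = Q.src (\<phi> e, b) \<and> Q.label d < Q.label (\<phi> e, b) \<and> Q.ray d 0"
    using lift_ray[OF d(3)] eb(1) by metis
qed

end

section \<open>The fibre product and its two projections\<close>

lemma etale_graph_bigraph:
  assumes "is_bigraph K" "etale K"
  shows "etale_graph K (dcol K)"
  using assms unfolding is_bigraph_def etale_def by unfold_locales blast+

theorem theorem2p2:
  fixes K :: "('v1, 'e1) bigraph" and L :: "('v2, 'e2) bigraph"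
  assumes "is_bigraph K" and "is_bigraph L" and "etale K" and "etale L"
  shows "reduced_cyclicity (fibre_product K L) \<le> reduced_cyclicity K * reduced_cyclicity L"
proof -
  interpret K: etale_graph K "dcol K" using assms by (intro etale_graph_bigraph)
  interpret L: etale_graph L "dcol L" using assms by (intro etale_graph_bigraph)
  let ?P = "fibre_product K L"
  have finP: "finite (dedges ?P)"
    by (rule finite_subset[of _ "dedges K \<times> dedges L"])
      (use assms in \<open>auto simp: fibre_product_def is_bigraph_def is_digraph_def\<close>)
  \<comment> \<open>The colour is read from the first factor; on edges of the fibre product it
    agrees with the second, so both projections preserve colours.\<close>
  interpret P: etale_graph ?P "\<lambda>e. dcol K (fst e)"
  proof
    show "is_digraph ?P"
      using finP assms(1,2) by (auto simp: fibre_product_def is_bigraph_def is_digraph_def)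
  qed (auto simp: fibre_product_def intro: K.etale_head K.etale_tail L.etale_head L.etale_tail)
  interpret P1: etale_morphism ?P "\<lambda>e. dcol K (fst e)" K "dcol K" fst fst
    by unfold_locales (auto simp: fibre_product_def)
  interpret P2: etale_morphism ?P "\<lambda>e. dcol K (fst e)" L "dcol L" snd snd
    by unfold_locales (auto simp: fibre_product_def)
  have "card {e. P.essential e} \<le> card ({e. K.essential e} \<times> {e. L.essential e})"
  proof (rule card_mono)
    show "finite ({e. K.essential e} \<times> {e. L.essential e})"
      using K.digraph L.digraph by (simp add: K.essential_def L.essential_def is_digraph_def)
    show "{e. P.essential e} \<subseteq> {e. K.essential e} \<times> {e. L.essential e}"
      using P1.lift_essential P2.lift_essential by auto
  qed
  then show ?thesis
    unfolding P.reduced_cyclicity_eq_card_essential K.reduced_cyclicity_eq_card_essential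
      L.reduced_cyclicity_eq_card_essential
    by (simp add: card_cartesian_product flip: of_nat_mult)
qed

end
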